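(* Let $\alpha\in(0,\tfrac12)$. If $\tilde v$ is distributed as a multivariate Gaussian, $\tilde v\sim\mathcal N(\bar v,S)$ on $\mathbb R^{nm}$, then the problem of maximizing the conditional value at risk of utilitarian welfare, $\max_{a\in\mathcal A}\mathrm{CVaR}_\alpha[a^\top\tilde v]$, simplifies to $$\max_{a\in\mathcal A}\ a^\top\bar v-\frac{\phi(\Phi^{-1}(\alpha))}{\alpha}\sqrt{a^\top Sa},$$ i.e. the two objectives coincide for every $a\in\mathcal A$, where $\phi$ and $\Phi$ are the probability density function and cumulative distribution function of the standard normal distribution $\mathcal N(0,1)$.
   Context: There are $n$ agents, partitioned into groups $\mathcal G$, and $m$ item types. Allocations $a\in\mathcal A\subseteq\mathbb R_{\ge0}^{nm}$ and valuations $v\in\mathbb R^{nm}$ are vectorized $n\times m$ matrices; $x_G$ is the restriction of a vector $x$ to the agents in $G$. Group utilities are $u_G(a,v)=a_G^\top v_G/|G|$ and weighted utilitarian welfare is $\sum_Gw_Gu_G$, with weights normalized to $w_G=|G|$, so that welfare equals $a^\top v$. For a real random variable $\tilde x$, $\mathrm{CVaR}_\alpha[\tilde x]=\max_{b\in\mathbb R}\{b-\frac1\alpha\mathbb E[(b-\tilde x)_+]\}$, $(x)_+=\max(x,0)$. *)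

theory Defs
  imports "HOL-Probability.Probability" "HOL-Library.Disjoint_Sets"
begin

subsection \<open>Groups and welfare\<close>

text \<open>Vectorized agent-by-item matrices live in \<open>real ^ ('n \<times> 'm)\<close>: \<open>'n\<close> is the type of
  agents, \<open>'m\<close> the type of item types, and \<open>x $ (i, j)\<close> is the entry of agent \<open>i\<close> and item \<open>j\<close>.\<close>

definition group_utility ::
    "'n set \<Rightarrow> real ^ ('n::finite \<times> 'm::finite) \<Rightarrow> real ^ ('n \<times> 'm) \<Rightarrow> real" where
  "group_utility G a v = (\<Sum>k \<in> G \<times> UNIV. a $ k * v $ k) / real (card G)"

definition weighted_welfare ::
    "'n set set \<Rightarrow> ('n set \<Rightarrow> real) \<Rightarrow> real ^ ('n::finite \<times> 'm::finite) \<Rightarrow> real ^ ('n \<times> 'm) \<Rightarrow> real"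
  where "weighted_welfare \<G> w a v = (\<Sum>G \<in> \<G>. w G * group_utility G a v)"

abbreviation utilitarian_welfare ::
    "'n set set \<Rightarrow> real ^ ('n::finite \<times> 'm::finite) \<Rightarrow> real ^ ('n \<times> 'm) \<Rightarrow> real" where
  "utilitarian_welfare \<G> \<equiv> weighted_welfare \<G> (\<lambda>G. real (card G))"

lemma utilitarian_welfare_eq_inner:
  fixes a v :: "real ^ ('n::finite \<times> 'm::finite)"
  assumes "partition_on (UNIV :: 'n set) \<G>"
  shows "utilitarian_welfare \<G> a v = a \<bullet> v"
proof -
  have ne: "card G \<noteq> 0" if "G \<in> \<G>" for G
    using assms that by (auto simp: partition_on_def)
  have "utilitarian_welfare \<G> a v = (\<Sum>G\<in>\<G>. \<Sum>k\<in>G \<times> UNIV. a $ k * v $ k)"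
    unfolding weighted_welfare_def group_utility_def by (intro sum.cong) (auto simp: ne)
  also have "\<dots> = (\<Sum>G\<in>\<G>. \<Sum>i\<in>G. \<Sum>j\<in>UNIV. a $ (i, j) * v $ (i, j))"
    by (simp add: sum.cartesian_product)
  also have "\<dots> = (\<Sum>i\<in>\<Union>\<G>. \<Sum>j\<in>UNIV. a $ (i, j) * v $ (i, j))"
    using assms by (subst sum.Union_disjoint) (auto simp: partition_on_def disjoint_def)
  also have "\<dots> = a \<bullet> v"
    using assms by (simp add: partition_on_def sum.cartesian_product inner_vec_def)
  finally show ?thesis .
qed

subsection \<open>Conditional value at risk\<close>

definition cvar_objective :: "'w measure \<Rightarrow> real \<Rightarrow> ('w \<Rightarrow> real) \<Rightarrow> real \<Rightarrow> real" where
  "cvar_objective M \<alpha> X b = b - 1 / \<alpha> * (\<integral>\<omega>. max (b - X \<omega>) 0 \<partial>M)"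

text \<open>The supremum is a maximum whenever \<open>X\<close> is integrable and \<open>0 < \<alpha> < 1\<close>; see
  \<open>cvar_is_max\<close> below.\<close>

definition cvar :: "'w measure \<Rightarrow> real \<Rightarrow> ('w \<Rightarrow> real) \<Rightarrow> real" where
  "cvar M \<alpha> X = (SUP b. cvar_objective M \<alpha> X b)"

lemma (in prob_space) cvar_is_max:
  fixes X :: "'a \<Rightarrow> real"
  assumes X [simp]: "integrable M X" and \<alpha>: "0 < \<alpha>" "\<alpha> < 1"
  shows "\<exists>b. cvar M \<alpha> X = cvar_objective M \<alpha> X b \<and>
             (\<forall>b'. cvar_objective M \<alpha> X b' \<le> cvar_objective M \<alpha> X b)"
proof -
  define f where "f = cvar_objective M \<alpha> X"
  define g where "g = (\<lambda>b. \<integral>\<omega>. max (b - X \<omega>) 0 \<partial>M)"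
  define K where "K = expectation X"
  have f: "f b = b - 1 / \<alpha> * g b" for b
    by (simp add: f_def g_def cvar_objective_def)
  have int: "integrable M (\<lambda>\<omega>. max (b - X \<omega>) 0)" for b
    by (intro integrable_max) auto
  have g_lip: "g b \<le> g c + \<bar>b - c\<bar>" for b c
  proof -
    have "g b \<le> (\<integral>\<omega>. max (c - X \<omega>) 0 + \<bar>b - c\<bar> \<partial>M)"
      unfolding g_def by (rule integral_mono) (use int in \<open>auto simp: max_def\<close>)
    also have "\<dots> = g c + \<bar>b - c\<bar>"
      unfolding g_def using int by (simp add: prob_space)
    finally show ?thesis .
  qed
  have "\<bar>g b - g c\<bar> \<le> \<bar>b - c\<bar>" for b c
    using g_lip[of b c] g_lip[of c b] by (simp add: abs_minus_commute abs_le_iff)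
  then have "1-lipschitz_on UNIV g"
    by (auto simp: lipschitz_on_def dist_real_def)
  then have "continuous_on UNIV g"
    by (rule lipschitz_on_continuous_on)
  then have cont: "continuous_on A f" for A
    unfolding f[abs_def] by (intro continuous_intros) (auto intro: continuous_on_subset)
  have g0: "0 \<le> g b" for b
    unfolding g_def by (rule integral_nonneg_AE) auto
  have gK: "b - K \<le> g b" for b
  proof -
    have "(\<integral>\<omega>. b - X \<omega> \<partial>M) \<le> g b"
      unfolding g_def by (rule integral_mono) (use int in auto)
    then show ?thesis by (simp add: K_def prob_space)
  qed
  have up1: "f b \<le> b" for b
    using g0[of b] \<alpha> by (simp add: f)
  have up2: "\<alpha> * f b \<le> K - (1 - \<alpha>) * b" for b
  proof -
    have "\<alpha> * f b = \<alpha> * b - g b"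
      using \<alpha> by (simp add: f right_diff_distrib)
    then show ?thesis using gK[of b] by (simp add: algebra_simps)
  qed
  define l where "l = min 0 (f 0)"
  define u where "u = max 0 ((K - \<alpha> * f 0) / (1 - \<alpha>))"
  have "\<exists>b\<in>{l..u}. \<forall>c\<in>{l..u}. f c \<le> f b"
    by (intro continuous_attains_sup cont) (auto simp: l_def u_def)
  then obtain b where b: "\<And>c. c \<in> {l..u} \<Longrightarrow> f c \<le> f b"
    by blast
  have max: "f c \<le> f b" for c
  proof -
    have 0: "f 0 \<le> f b"
      by (rule b) (auto simp: l_def u_def)
    consider "c < l" | "c \<in> {l..u}" | "u < c" by force
    then show ?thesis
    proof cases
      case 1
      then show ?thesis using up1[of c] 0 by (simp add: l_def)
    next
      case 3
      then have "(K - \<alpha> * f 0) / (1 - \<alpha>) < c" by (simp add: u_def)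
      then have "K - \<alpha> * f 0 < c * (1 - \<alpha>)"
        using \<alpha> by (simp add: divide_less_eq)
      then have "\<alpha> * f c < \<alpha> * f 0"
        using up2[of c] by (simp add: mult.commute)
      then show ?thesis using 0 \<alpha> by simp
    qed (rule b)
  qed
  have "cvar M \<alpha> X = f b"
    unfolding cvar_def f_def[symmetric] by (rule cSup_eq_maximum) (use max in auto)
  then show ?thesis using max unfolding f_def by blast
qed

subsection \<open>Normal distributions\<close>

text \<open>The library's cumulative distribution function \<open>cdf\<close> of the standard normal law is a strictly
  increasing map from the reals onto the open unit interval, so \<open>inv\<close> is its genuine inverse at
  every point of that interval.\<close>

definition std_normal_cdf :: "real \<Rightarrow> real" where
  "std_normal_cdf = cdf std_normal_distribution"

definition std_normal_quantile :: "real \<Rightarrow> real" where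
  "std_normal_quantile = inv std_normal_cdf"

text \<open>\<open>X\<close> has law \<open>N(\<mu>, S)\<close> iff it is distributed as \<open>\<mu> + A Z\<close> for a vector \<open>Z\<close> of independent
  standard normal variables and a matrix \<open>A\<close> with \<open>A A\<^sup>T = S\<close>. Every positive semidefinite
  covariance matrix \<open>S\<close> is of this form with a square \<open>A\<close>; singular \<open>S\<close> (no density) is allowed.\<close>

definition multivariate_normal ::
    "'w measure \<Rightarrow> ('w \<Rightarrow> real ^ 'k::finite) \<Rightarrow> real ^ 'k \<Rightarrow> real ^ 'k ^ 'k \<Rightarrow> bool" where
  "multivariate_normal M X \<mu> S \<longleftrightarrow>
     X \<in> borel_measurable M \<and>
     (\<exists>A :: real ^ 'k ^ 'k. A ** transpose A = S \<and>
        distr M borel X =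
        distr (\<Pi>\<^sub>M i\<in>UNIV. std_normal_distribution) borel (\<lambda>z. \<mu> + A *v (\<chi> i. z i)))"

end

theory Submission
  imports Defs "HOL-Real_Asymp.Real_Asymp"
begin

text \<open>
  If an event \<open>B\<close> of probability \<open>\<alpha>\<close> carries the lower tail of \<open>X\<close>, then the threshold separating
  \<open>X\<close> on \<open>B\<close> from \<open>X\<close> off \<open>B\<close> maximizes the CVaR objective, and the maximum is the tail mean
  \<open>E[X; B] / \<alpha>\<close>. Comparing characteristic functions, \<open>a \<bullet> v\<close> has the law of \<open>a \<bullet> v_bar + s * Z\<close> with
  \<open>Z\<close> standard normal and \<open>s\<^sup>2 = a \<bullet> (S *v a)\<close>. The tail mean of \<open>Z\<close> over \<open>Z \<le> q\<close> is explicit because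
  \<open>- std_normal_density\<close> is an antiderivative of \<open>x * std_normal_density x\<close>. Phrasing the tail through
  an event instead of a quantile of \<open>X\<close> lets the degenerate case \<open>s = 0\<close> go through unchanged.
\<close>

subsection \<open>Conditional value at risk as a tail mean\<close>

text \<open>CVaR depends on a random variable only through its law, so \<open>M\<close> can later be
  traded for a product of standard normals.\<close>

lemma cvar_distr:
  assumes "g \<in> measurable M N" "X \<in> borel_measurable N"
  shows "cvar (distr M N g) \<alpha> X = cvar M \<alpha> (\<lambda>\<omega>. X (g \<omega>))"
proof -
  have "cvar_objective (distr M N g) \<alpha> X b = cvar_objective M \<alpha> (\<lambda>\<omega>. X (g \<omega>)) b" for b
    unfolding cvar_objective_def using assms by (subst integral_distr) auto
  then show ?thesis by (simp add: cvar_def)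
qed

text \<open>Pointwise \<open>max (b - X \<omega>) 0\<close> dominates
  \<open>indicator B \<omega> * (b - X \<omega>)\<close>, which bounds the objective by the tail
  mean for every \<open>b\<close>. At \<open>b = q\<close> the two agree, since \<open>q - X\<close>
  is nonnegative on \<open>B\<close> and nonpositive off it.\<close>

lemma (in prob_space) cvar_eq_tail_mean:
  fixes X :: "'a \<Rightarrow> real"
  assumes X [simp]: "integrable M X" and B [measurable]: "B \<in> events"
    and \<alpha>: "prob B = \<alpha>" "0 < \<alpha>"
    and lower: "\<And>\<omega>. \<omega> \<in> B \<Longrightarrow> X \<omega> \<le> q"
    and upper: "\<And>\<omega>. \<omega> \<in> space M - B \<Longrightarrow> q \<le> X \<omega>"
  shows "cvar M \<alpha> X = (\<integral>\<omega>. indicator B \<omega> * X \<omega> \<partial>M) / \<alpha>"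
proof -
  define t where "t = (\<integral>\<omega>. indicator B \<omega> * X \<omega> \<partial>M)"
  have int_max: "integrable M (\<lambda>\<omega>. max (b - X \<omega>) 0)" for b
    by (intro integrable_max) auto
  have int_B: "integrable M (\<lambda>\<omega>. indicator B \<omega> * (b - X \<omega>))" for b
    using integrable_mult_indicator[OF B, of "\<lambda>\<omega>. b - X \<omega>"] by simp
  have tail: "(\<integral>\<omega>. indicator B \<omega> * (b - X \<omega>) \<partial>M) = b * \<alpha> - t" for b
  proof -
    have "(\<integral>\<omega>. indicator B \<omega> * (b - X \<omega>) \<partial>M)
        = (\<integral>\<omega>. b * indicator B \<omega> - indicator B \<omega> * X \<omega> \<partial>M)"
      by (simp add: algebra_simps)
    \<comment> \<open>The case \<open>b = 0\<close> of \<open>int_B\<close> is, up to sign,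
      integrability of \<open>X\<close> on \<open>B\<close>.\<close>
    also have "\<dots> = b * \<alpha> - t"
      unfolding t_def
      by (subst Bochner_Integration.integral_diff)
         (use \<alpha> int_B[of 0] in \<open>auto simp: emeasure_eq_measure\<close>)
    finally show ?thesis .
  qed
  have le: "cvar_objective M \<alpha> X b \<le> t / \<alpha>" for b
  proof -
    have "b * \<alpha> - t \<le> (\<integral>\<omega>. max (b - X \<omega>) 0 \<partial>M)"
      unfolding tail[symmetric]
      by (rule integral_mono[OF int_B int_max]) (auto simp: indicator_def)
    then have "(b * \<alpha> - t) / \<alpha> \<le> (\<integral>\<omega>. max (b - X \<omega>) 0 \<partial>M) / \<alpha>"
      using \<alpha> by (intro divide_right_mono) auto
    then show ?thesis
      using \<alpha>(2) by (simp add: cvar_objective_def diff_divide_distrib)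
  qed
  have "(\<integral>\<omega>. max (q - X \<omega>) 0 \<partial>M) = (\<integral>\<omega>. indicator B \<omega> * (q - X \<omega>) \<partial>M)"
    by (rule Bochner_Integration.integral_cong)
       (use lower upper in \<open>force simp: indicator_def max_def\<close>)+
  then have "cvar_objective M \<alpha> X q = t / \<alpha>"
    unfolding cvar_objective_def tail using \<alpha> by (simp add: field_simps)
  then show ?thesis
    unfolding cvar_def t_def[symmetric]
    by (intro cSup_eq_maximum) (use le in \<open>auto intro: range_eqI[of _ _ q]\<close>)
qed

subsection \<open>The standard normal distribution\<close>

interpretation std_normal: real_distribution std_normal_distribution
  by (rule real_dist_normal_dist)

text \<open>\<open>inv\<close> returns a preimage of any value in the range, so it suffices that
  \<alpha> is attained: the law has no atoms, hence its cdf is continuous, and the limits 0 and 1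
  bracket \<alpha>.\<close>

lemma std_normal_cdf_quantile:
  assumes "0 < \<alpha>" "\<alpha> < 1"
  shows "std_normal_cdf (std_normal_quantile \<alpha>) = \<alpha>"
proof -
  have cont: "isCont std_normal_cdf x" for x
  proof -
    have "emeasure std_normal_distribution {x} = 0"
      by (subst emeasure_density) (auto intro!: nn_integral_0_iff_AE[THEN iffD2]
        AE_I'[of "{x}"] simp: null_sets_def indicator_def)
    then show ?thesis
      by (simp add: std_normal_cdf_def std_normal.isCont_cdf measure_def)
  qed
  have "\<forall>\<^sub>F x in at_bot. std_normal_cdf x < \<alpha>"
    unfolding std_normal_cdf_def
    by (rule order_tendstoD(2)[OF std_normal.cdf_lim_at_bot]) fact
  then obtain l where l: "std_normal_cdf l < \<alpha>"
    by (auto simp: eventually_at_bot_linorder)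
  have "\<forall>\<^sub>F x in at_top. \<alpha> < std_normal_cdf x"
    unfolding std_normal_cdf_def
    by (rule order_tendstoD(1)[OF std_normal.cdf_lim_at_top_prob]) fact
  then obtain u where u: "\<alpha> < std_normal_cdf u"
    by (auto simp: eventually_at_top_linorder)
  have "l \<le> u"
    using l u std_normal.cdf_nondecreasing[of u l] unfolding std_normal_cdf_def by linarith
  then have "\<exists>x. l \<le> x \<and> x \<le> u \<and> std_normal_cdf x = \<alpha>"
    by (intro IVT) (use l u cont in auto)
  then have "\<alpha> \<in> range std_normal_cdf" by auto
  then show ?thesis
    unfolding std_normal_quantile_def by (rule f_inv_into_f)
qed

lemma std_normal_tail_mean:
  "(\<integral>x. indicator {..q} x * x \<partial>std_normal_distribution) = - std_normal_density q"
proof -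
  let ?f = "\<lambda>x. std_normal_density x * x" and ?F = "\<lambda>x. - std_normal_density x"
  have deriv: "(?F has_vector_derivative ?f x) (at x)" for x
    unfolding has_real_derivative_iff_has_vector_derivative[symmetric] std_normal_density_def
    by (auto intro!: derivative_eq_intros simp: field_simps)
  have "(?F \<longlongrightarrow> 0) at_bot"
    unfolding std_normal_density_def by real_asymp
  \<comment> \<open>The fundamental theorem on an unbounded interval takes boundary values as limits
    at extended real endpoints.\<close>
  then have lim_bot: "((?F \<circ> real_of_ereal) \<longlongrightarrow> 0) (at_right (-\<infinity>))"
    by (simp add: ereal_tendsto_simps)
  have "isCont ?F q"
    unfolding std_normal_density_def by (intro continuous_intros) auto
  then have "(?F \<longlongrightarrow> ?F q) (at_left q)"
    by (auto simp: isCont_def intro: filterlim_mono at_le)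
  then have lim_q: "((?F \<circ> real_of_ereal) \<longlongrightarrow> ?F q) (at_left (ereal q))"
    by (simp add: ereal_tendsto_simps)
  have "integrable lborel ?f"
    using integrable_std_normal_moment[of 1] by simp
  then have int: "set_integrable lborel (einterval (-\<infinity>) (ereal q)) ?f"
    unfolding set_integrable_def by (intro integrable_mult_indicator) auto
  have "(LBINT x=-\<infinity>..ereal q. ?f x) = ?F q - 0"
    by (rule interval_integral_FTC_integrable[OF _ deriv _ int lim_bot lim_q])
       (auto simp: std_normal_density_def intro!: continuous_intros)
  \<comment> \<open>The open interval and \<open>{..q}\<close> differ only in the null set
    \<open>{q}\<close>.\<close>
  moreover have "(LBINT x=-\<infinity>..ereal q. ?f x) = (\<integral>x. std_normal_density x * (indicator {..q} x * x) \<partial>lborel)"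
    unfolding interval_lebesgue_integral_def set_lebesgue_integral_def
    by (auto intro!: integral_cong_AE AE_I'[of "{q}"] simp: einterval_def indicator_def of_bool_def
        split: if_splits)
  ultimately show ?thesis
    by (subst integral_density) auto
qed

text \<open>By independence the characteristic function of the sum factors, and both laws get
  \<open>exp (- t^2 * (\<Sum>i\<in>I. (c i)^2) / 2)\<close>. If all \<open>c i\<close> vanish, both
  are the point mass at 0.\<close>

lemma distr_PiM_std_normal_sum:
  assumes "finite I"
  shows "distr (\<Pi>\<^sub>M i\<in>I. std_normal_distribution) borel (\<lambda>z. \<Sum>i\<in>I. c i * z i) =
         distr std_normal_distribution borel (\<lambda>x. sqrt (\<Sum>i\<in>I. (c i)\<^sup>2) * x)"
    (is "distr ?P borel ?X = distr ?N borel ?Y")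
proof (rule Levy_uniqueness)
  interpret PiM: prob_space ?P
    by (intro prob_space_PiM std_normal.prob_space_axioms)
  interpret product_sigma_finite "\<lambda>_. ?N"
    by unfold_locales
  have [measurable]: "?X \<in> borel_measurable ?P"
  proof (intro borel_measurable_sum borel_measurable_times measurable_const)
    show "(\<lambda>z. z i) \<in> borel_measurable ?P" if "i \<in> I" for i
      using measurable_component_singleton[OF that, of "\<lambda>_. ?N"] by simp
  qed auto
  show "real_distribution (distr ?P borel ?X)" by simp
  show "real_distribution (distr ?N borel ?Y)" by simp
  show "char (distr ?P borel ?X) = char (distr ?N borel ?Y)"
  proof
    fix t
    have "char (distr ?P borel ?X) t = (CLINT z|?P. (\<Prod>i\<in>I. iexp (t * c i * z i)))"
      by (simp add: char_def integral_distr exp_sum[OF assms, symmetric] sum_distrib_left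
          mult.assoc)
    also have "\<dots> = (\<Prod>i\<in>I. CLINT x|?N. iexp (t * c i * x))"
      by (rule product_integral_prod[OF assms]) (intro std_normal.integrable_iexp, auto)
    also have "\<dots> = (\<Prod>i\<in>I. char ?N (t * c i))"
      by (simp add: char_def)
    also have "\<dots> = exp (\<Sum>i\<in>I. - (t * c i)\<^sup>2 / 2)"
      unfolding char_std_normal_distribution by (simp add: exp_sum[OF assms])
    also have "(\<Sum>i\<in>I. - (t * c i)\<^sup>2 / 2) = - (t * sqrt (\<Sum>i\<in>I. (c i)\<^sup>2))\<^sup>2 / 2"
      by (simp add: power_mult_distrib sum_nonneg sum_distrib_left sum_negf sum_divide_distrib)
    also have "complex_of_real (exp \<dots>) = char ?N (t * sqrt (\<Sum>i\<in>I. (c i)\<^sup>2))"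
      by (simp add: char_std_normal_distribution)
    also have "\<dots> = char (distr ?N borel ?Y) t"
      by (simp add: char_def integral_distr mult.assoc)
    finally show "char (distr ?P borel ?X) t = char (distr ?N borel ?Y) t" .
  qed
qed

lemma cvar_std_normal_affine:
  assumes \<alpha>: "0 < \<alpha>" "\<alpha> < 1" and "0 \<le> s"
  shows "cvar std_normal_distribution \<alpha> (\<lambda>x. \<mu> + s * x) =
         \<mu> - std_normal_density (std_normal_quantile \<alpha>) / \<alpha> * s"
proof -
  define q where "q = std_normal_quantile \<alpha>"
  have prob: "std_normal.prob {..q} = \<alpha>"
    using std_normal_cdf_quantile[OF \<alpha>] by (simp add: q_def std_normal_cdf_def cdf_def)
  have int: "integrable std_normal_distribution (\<lambda>x. x)"
    using integrable_std_normal_distribution_moment[of 1] by simp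
  have "cvar std_normal_distribution \<alpha> (\<lambda>x. \<mu> + s * x) =
      (\<integral>x. indicator {..q} x * (\<mu> + s * x) \<partial>std_normal_distribution) / \<alpha>"
    \<comment> \<open>As \<open>s\<close> is nonnegative, the map is monotone and
      \<open>{..q}\<close> carries its lower tail; for \<open>s = 0\<close> the variable equals the
      threshold everywhere.\<close>
    by (rule std_normal.cvar_eq_tail_mean[where q = "\<mu> + s * q"])
       (use int prob assms in \<open>auto intro: mult_left_mono\<close>)
  also have "(\<integral>x. indicator {..q} x * (\<mu> + s * x) \<partial>std_normal_distribution) =
      (\<integral>x. \<mu> * indicator {..q} x + s * (indicator {..q} x * x) \<partial>std_normal_distribution)"
    by (simp add: algebra_simps)
  also have "\<dots> = \<mu> * \<alpha> - s * std_normal_density q"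
    using integrable_mult_indicator[OF _ int, of "{..q}"] prob
    by (subst Bochner_Integration.integral_add)
       (auto simp: std_normal_tail_mean std_normal.emeasure_eq_measure)
  finally show ?thesis
    using \<alpha> by (simp add: q_def field_simps)
qed

lemma cvar_inner_multivariate_normal:
  fixes X :: "'w \<Rightarrow> real ^ 'k::finite"
  assumes "multivariate_normal M X \<mu> S" and \<alpha>: "0 < \<alpha>" "\<alpha> < 1"
  shows "cvar M \<alpha> (\<lambda>\<omega>. a \<bullet> X \<omega>) =
         a \<bullet> \<mu> - std_normal_density (std_normal_quantile \<alpha>) / \<alpha> * sqrt (a \<bullet> (S *v a))"
proof -
  let ?N = std_normal_distribution
  let ?P = "\<Pi>\<^sub>M i\<in>(UNIV :: 'k set). ?N"
  obtain A where X [measurable]: "X \<in> borel_measurable M" and A: "A ** transpose A = S"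
    and law: "distr M borel X = distr ?P borel (\<lambda>z. \<mu> + A *v (\<chi> i. z i))"
    using assms(1) unfolding multivariate_normal_def by blast
  \<comment> \<open>Moving \<open>A\<close> across the inner product gives the coefficients of
    \<open>a \<bullet> X\<close> in the independent normals.\<close>
  define c where "c = transpose A *v a"
  have comp [measurable]: "(\<lambda>z. z i) \<in> borel_measurable ?P" for i
    using measurable_component_singleton[of i UNIV "\<lambda>_. ?N"] by simp
  have vec [measurable]: "(\<lambda>z. \<mu> + A *v (\<chi> i. z i)) \<in> borel_measurable ?P"
    by (subst borel_measurable_euclidean_space)
       (auto simp: Basis_vec_def inner_axis matrix_vector_mult_def)
  have inner: "a \<bullet> (A *v z) = (\<Sum>i\<in>UNIV. c $ i * z $ i)" for z
  proof -
    have "a \<bullet> (A *v z) = c \<bullet> z" by (simp add: c_def dot_lmul_matrix)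
    then show ?thesis by (simp add: inner_vec_def)
  qed
  \<comment> \<open>Putting \<open>z = c\<close> in \<open>inner\<close> makes \<open>A\<close> meet
    its transpose, whose product is \<open>S\<close>.\<close>
  have norm: "(\<Sum>i\<in>UNIV. (c $ i)\<^sup>2) = a \<bullet> (S *v a)"
    using inner[of c]
    by (simp add: c_def A[symmetric] matrix_vector_mul_assoc[symmetric] power2_eq_square)
  have "cvar M \<alpha> (\<lambda>\<omega>. a \<bullet> X \<omega>) = cvar (distr M borel X) \<alpha> (\<lambda>x. a \<bullet> x)"
    by (simp add: cvar_distr)
  also have "\<dots> = cvar ?P \<alpha> (\<lambda>z. a \<bullet> (\<mu> + A *v (\<chi> i. z i)))"
    unfolding law using vec by (subst cvar_distr) auto
  also have "\<dots> = cvar ?P \<alpha> (\<lambda>z. a \<bullet> \<mu> + (\<Sum>i\<in>UNIV. c $ i * z i))"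
    by (simp add: inner_add_right inner)
  \<comment> \<open>The mean stays in the outer function, so that only the law of the centered sum
    is replaced.\<close>
  also have "\<dots> = cvar (distr ?P borel (\<lambda>z. \<Sum>i\<in>UNIV. c $ i * z i)) \<alpha> (\<lambda>x. a \<bullet> \<mu> + x)"
    by (subst cvar_distr) auto
  also have "\<dots> = cvar ?N \<alpha> (\<lambda>x. a \<bullet> \<mu> + sqrt (a \<bullet> (S *v a)) * x)"
    by (simp add: distr_PiM_std_normal_sum norm cvar_distr)
  also have "\<dots> = a \<bullet> \<mu> - std_normal_density (std_normal_quantile \<alpha>) / \<alpha> * sqrt (a \<bullet> (S *v a))"
    by (rule cvar_std_normal_affine[OF \<alpha>]) (simp add: norm[symmetric] sum_nonneg)
  finally show ?thesis .
qed

theorem proposition4p3: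
  fixes M :: "'w measure"
    and \<G> :: "'n::finite set set"
    and \<A> :: "(real ^ ('n \<times> 'm::finite)) set"
    and v :: "'w \<Rightarrow> real ^ ('n \<times> 'm)"
    and v_bar :: "real ^ ('n \<times> 'm)"
    and S :: "real ^ ('n \<times> 'm) ^ ('n \<times> 'm)"
    and \<alpha> :: real
  assumes "prob_space M"
    and "partition_on UNIV \<G>"
    and "\<And>a k. a \<in> \<A> \<Longrightarrow> 0 \<le> a $ k"
    and "0 < \<alpha>" and "\<alpha> < 1 / 2"
    and "multivariate_normal M v v_bar S"
  shows "\<forall>a\<in>\<A>.
           cvar M \<alpha> (\<lambda>\<omega>. utilitarian_welfare \<G> a (v \<omega>)) = cvar M \<alpha> (\<lambda>\<omega>. a \<bullet> v \<omega>) \<and>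
           cvar M \<alpha> (\<lambda>\<omega>. a \<bullet> v \<omega>) =
             a \<bullet> v_bar - std_normal_density (std_normal_quantile \<alpha>) / \<alpha> * sqrt (a \<bullet> (S *v a))"
proof -
  have "\<alpha> < 1" using assms(5) by simp
  then show ?thesis
    using cvar_inner_multivariate_normal[OF assms(6,4)] assms(2)
    by (simp add: utilitarian_welfare_eq_inner)
qed

end
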